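(* Let $\mathcal G$ be a hereditary class of oriented graphs satisfying the weighted half-neighborhood property. Then every source-free digraph $D\in\mathcal G$ on $n$ vertices has a quasi-kernel $Q$ such that $$|Q|\le \frac{2n}{3}.$$
   Context: All digraphs are finite and loopless. An oriented graph is a digraph with no pair of opposite arcs. A class of oriented graphs is hereditary if it is closed under taking induced subdigraphs. A vertex is a source if it has no in-neighbor; a digraph is source-free if it has no source. A set $X\subseteq V(D)$ is independent if there is no arc between any two vertices of $X$. A quasi-kernel of a digraph $D$ is an independent set $Q\subseteq V(D)$ such that every vertex of $D$ is reachable from some vertex of $Q$ by a directed path of length at most $2$ (length $0$ allowed). For $X\subseteq V(D)$, $N_D^+[X]=X\cup\{u\in V(D)\setminus X : xu\in A(D)\text{ for some }x\in X\}$, where $A(D)$ is the arc set. For $f:V(D)\to\mathbb Z_{\ge 0}$ and $X\subseteq V(D)$, $f(X)=\sum_{x\in X}f(x)$. A hereditary class $\mathcal G$ of oriented graphs satisfies the weighted half-neighborhood property if for every $H\in\mathcal G$ and every function $f:V(H)\to\mathbb Z_{\ge 0}$ there exists a quasi-kernel $Q$ of $H$ such that $f(N_H^+[Q])\ge f(V(H))/2$. *)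

theory Defs
  imports Complex_Main "Graph_Theory.Digraph_Component"
begin

text \<open>The library locale \<open>digraph\<close> means finite, loopless and without parallel arcs.\<close>

definition oriented_graph :: "('a, 'b) pre_digraph \<Rightarrow> bool" where
  "oriented_graph D \<longleftrightarrow>
     digraph D \<and> \<not> (\<exists>u v. u \<rightarrow>\<^bsub>D\<^esub> v \<and> v \<rightarrow>\<^bsub>D\<^esub> u)"

definition hereditary :: "('a, 'b) pre_digraph set \<Rightarrow> bool" where
  "hereditary \<G> \<longleftrightarrow> (\<forall>D\<in>\<G>. \<forall>H. induced_subgraph H D \<longrightarrow> H \<in> \<G>)"

definition source :: "('a, 'b) pre_digraph \<Rightarrow> 'a \<Rightarrow> bool" where
  "source D v \<longleftrightarrow> v \<in> verts D \<and> \<not> (\<exists>u\<in>verts D. u \<rightarrow>\<^bsub>D\<^esub> v)"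

definition source_free :: "('a, 'b) pre_digraph \<Rightarrow> bool" where
  "source_free D \<longleftrightarrow> \<not> (\<exists>v. source D v)"

definition independent_set :: "('a, 'b) pre_digraph \<Rightarrow> 'a set \<Rightarrow> bool" where
  "independent_set D X \<longleftrightarrow>
     X \<subseteq> verts D \<and> (\<forall>x\<in>X. \<forall>y\<in>X. \<not> x \<rightarrow>\<^bsub>D\<^esub> y)"

text \<open>Paths are lists of arcs, so \<open>length p\<close> is the length of the path.\<close>

definition quasi_kernel :: "('a, 'b) pre_digraph \<Rightarrow> 'a set \<Rightarrow> bool" where
  "quasi_kernel D Q \<longleftrightarrow>
     independent_set D Q \<and>
     (\<forall>v\<in>verts D. \<exists>q\<in>Q. \<exists>p. pre_digraph.apath D q p v \<and> length p \<le> 2)"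

definition closed_out_nbhd :: "('a, 'b) pre_digraph \<Rightarrow> 'a set \<Rightarrow> 'a set" where
  "closed_out_nbhd D X = X \<union> {u \<in> verts D - X. \<exists>x\<in>X. x \<rightarrow>\<^bsub>D\<^esub> u}"

text \<open>A weight is a total function on the vertex type; only its values on
  \<open>verts H\<close> matter.\<close>

definition weighted_half_nbhd_property :: "('a, 'b) pre_digraph set \<Rightarrow> bool" where
  "weighted_half_nbhd_property \<G> \<longleftrightarrow>
     (\<forall>H\<in>\<G>. \<forall>f :: 'a \<Rightarrow> nat. \<exists>Q. quasi_kernel H Q \<and>
        real (\<Sum>x\<in>closed_out_nbhd H Q. f x) \<ge> real (\<Sum>x\<in>verts H. f x) / 2)"

end

theory Submission
  imports Defs
begin

text \<open>
  Let \<open>Q\<close> be any quasi-kernel, \<open>A\<close> its set of out-neighbours and \<open>B\<close> the remaining vertices. Choose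
  \<open>T \<subseteq> Q\<close> with \<open>|T| \<le> |A|\<close> dominating \<open>A\<close>, and let \<open>C\<close> be the set of vertices of \<open>Q - T\<close> without
  in-neighbours in \<open>A\<close>. Then \<open>T \<union> C\<close> is a quasi-kernel of size at most \<open>|A| + |C|\<close>.
  On the other hand, every \<open>q \<in> C\<close> has an in-neighbour \<open>p q \<in> B\<close>. The weighted half-neighbourhood
  property of \<open>D[B]\<close> for the weight \<open>w \<mapsto> |{q \<in> C. p q = w}|\<close> yields a quasi-kernel \<open>Q'\<close> of \<open>D[B]\<close>
  that reaches at least half of \<open>C\<close> in at most two steps. As there are no arcs from \<open>Q\<close> to \<open>B\<close>,
  adding to \<open>Q'\<close> the vertices of \<open>Q\<close> that are neither dominated by \<open>Q'\<close> nor in this half of \<open>C\<close>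
  gives a quasi-kernel of \<open>D\<close> of size at most \<open>n - |A| - |C| / 2\<close>. The first bound plus twice the
  second is at most \<open>2 n\<close>, so one of them is at most \<open>2 n / 3\<close>.
\<close>

lemma (in wf_digraph) apath_length_le_2_iff:
  assumes "q \<in> verts G"
  shows "(\<exists>p. apath q p v \<and> length p \<le> 2) \<longleftrightarrow> v = q \<or> q \<rightarrow>\<^bsub>G\<^esub> v \<or> (\<exists>w. q \<rightarrow>\<^bsub>G\<^esub> w \<and> w \<rightarrow>\<^bsub>G\<^esub> v)"
    (is "?L \<longleftrightarrow> ?R")
proof
  assume ?L
  then obtain p where p: "apath q p v" "length p \<le> 2" by blast
  then consider "p = []" | e where "p = [e]" | e e' where "p = [e, e']"
    by (cases p rule: remdups_adj.cases) auto
  then show ?R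
    using p(1) by cases (auto simp: apath_def awalk_simps arcs_ends_conv)
next
  assume ?R
  \<comment> \<open>An \<open>apath\<close> repeats no vertex, so the two-arc case must have three
    distinct vertices: if \<open>w\<close> equals \<open>q\<close> or \<open>v\<close>, one of the
    two arcs already goes from \<open>q\<close> to \<open>v\<close>.\<close>
  then consider "v = q" | "v \<noteq> q" "q \<rightarrow>\<^bsub>G\<^esub> v"
    | w where "v \<noteq> q" "w \<noteq> q" "w \<noteq> v" "q \<rightarrow>\<^bsub>G\<^esub> w" "w \<rightarrow>\<^bsub>G\<^esub> v"
    by metis
  then show ?L
  proof cases
    case 1
    then have "apath q [] v" using assms by (simp add: apath_Nil_iff)
    then show ?thesis by (intro exI[of _ "[]"]) simp
  next
    case 2
    then obtain e where "e \<in> arcs G" "tail G e = q" "head G e = v" by blast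
    then have "apath q [e] v" using 2 by (auto simp: apath_def awalk_simps)
    then show ?thesis by (intro exI[of _ "[e]"]) simp
  next
    case 3
    then obtain e e' where "e \<in> arcs G" "tail G e = q" "head G e = w"
      "e' \<in> arcs G" "tail G e' = w" "head G e' = v" by (meson reachableE)
    then have "apath q [e, e'] v" using 3 by (auto simp: apath_def awalk_simps)
    then show ?thesis by (intro exI[of _ "[e, e']"]) simp
  qed
qed

lemma (in wf_digraph) quasi_kernel_iff:
  "quasi_kernel G Q \<longleftrightarrow> independent_set G Q \<and>
     (\<forall>v\<in>verts G. \<exists>q\<in>Q. v = q \<or> q \<rightarrow>\<^bsub>G\<^esub> v \<or> (\<exists>w. q \<rightarrow>\<^bsub>G\<^esub> w \<and> w \<rightarrow>\<^bsub>G\<^esub> v))"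
\<comment> \<open>Independence includes \<open>Q \<subseteq> verts G\<close>, which the empty path
  at \<open>q\<close> requires.\<close>
proof (cases "independent_set G Q")
  case True
  then have "q \<in> verts G" if "q \<in> Q" for q
    using that by (auto simp: independent_set_def)
  then show ?thesis
    using True by (simp add: quasi_kernel_def apath_length_le_2_iff cong: bex_cong)
qed (simp add: quasi_kernel_def)

lemma (in wf_digraph) quasi_kernel_cases:
  assumes "quasi_kernel G Q" "v \<in> verts G"
  obtains "v \<in> Q" | q where "q \<in> Q" "q \<rightarrow>\<^bsub>G\<^esub> v" | q w where "q \<in> Q" "q \<rightarrow>\<^bsub>G\<^esub> w" "w \<rightarrow>\<^bsub>G\<^esub> v"
  using assms unfolding quasi_kernel_iff by metis

text \<open>\<open>T\<close> has the same out-neighbours as \<open>Q\<close>, so whatever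
  \<open>Q\<close> reaches in one or two steps is still reached from \<open>T\<close>. A discarded
  vertex of \<open>Q\<close> has an in-neighbour dominated by \<open>T\<close>, hence is two steps
  from \<open>T\<close>.\<close>

lemma (in wf_digraph) quasi_kernel_prune:
  assumes qk: "quasi_kernel G Q" and "T \<subseteq> Q"
    and T: "\<And>q v. q \<in> Q \<Longrightarrow> q \<rightarrow>\<^bsub>G\<^esub> v \<Longrightarrow> \<exists>t\<in>T. t \<rightarrow>\<^bsub>G\<^esub> v"
  shows "quasi_kernel G (T \<union> {q \<in> Q - T. \<forall>t\<in>T. \<forall>u. t \<rightarrow>\<^bsub>G\<^esub> u \<longrightarrow> \<not> u \<rightarrow>\<^bsub>G\<^esub> q})"
    (is "quasi_kernel G ?Q1")
proof -
  have "?Q1 \<subseteq> Q" using \<open>T \<subseteq> Q\<close> by blast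
  then have "independent_set G ?Q1"
    using qk unfolding quasi_kernel_def independent_set_def by blast
  moreover have "\<exists>q\<in>?Q1. v = q \<or> q \<rightarrow>\<^bsub>G\<^esub> v \<or> (\<exists>w. q \<rightarrow>\<^bsub>G\<^esub> w \<and> w \<rightarrow>\<^bsub>G\<^esub> v)" if "v \<in> verts G" for v
    using qk that
  proof (cases rule: quasi_kernel_cases)
    case 1
    then show ?thesis by blast
  next
    case (2 q)
    then show ?thesis using T[of q v] by blast
  next
    case (3 q w)
    then show ?thesis using T[of q w] by blast
  qed
  ultimately show ?thesis by (simp add: quasi_kernel_iff)
qed

text \<open>Independence survives because no arc leads from \<open>Q\<close> to \<open>B\<close> and
  the vertices of \<open>Q\<close> dominated by \<open>Q'\<close> are removed. \<open>Q'\<close>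
  covers \<open>B\<close>, and it reaches \<open>R\<close> through the in-neighbours given by the
  last assumption.\<close>

lemma (in wf_digraph) quasi_kernel_exchange:
  assumes qk: "quasi_kernel G Q" and "T \<subseteq> Q"
    and T: "\<And>q v. q \<in> Q \<Longrightarrow> q \<rightarrow>\<^bsub>G\<^esub> v \<Longrightarrow> \<exists>t\<in>T. t \<rightarrow>\<^bsub>G\<^esub> v"
    and B: "B = verts G - closed_out_nbhd G Q"
    and qk': "quasi_kernel (G \<restriction> B) Q'"
    and RT: "R \<inter> T = {}"
    and R: "\<And>r. r \<in> R \<Longrightarrow> \<exists>u\<in>closed_out_nbhd (G \<restriction> B) Q'. u \<rightarrow>\<^bsub>G\<^esub> r"
  shows "quasi_kernel G (Q' \<union> (Q - R - {v. \<exists>q\<in>Q'. q \<rightarrow>\<^bsub>G\<^esub> v}))"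
    (is "quasi_kernel G ?Q2")
proof -
  interpret H: wf_digraph "G \<restriction> B" using B by (intro wellformed_induce_subgraph)
  have dom: "u \<rightarrow>\<^bsub>G \<restriction> B\<^esub> v \<longleftrightarrow> u \<rightarrow>\<^bsub>G\<^esub> v \<and> u \<in> B \<and> v \<in> B" for u v
    by (auto simp: arcs_ends_conv)
  have Q: "Q \<subseteq> verts G" "\<And>x y. x \<in> Q \<Longrightarrow> y \<in> Q \<Longrightarrow> \<not> x \<rightarrow>\<^bsub>G\<^esub> y"
    using qk unfolding quasi_kernel_def independent_set_def by auto
  have Q': "Q' \<subseteq> B" "\<And>x y. x \<in> Q' \<Longrightarrow> y \<in> Q' \<Longrightarrow> \<not> x \<rightarrow>\<^bsub>G\<^esub> y"
    using qk' unfolding quasi_kernel_def independent_set_def dom by auto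
  have QB: "\<not> q \<rightarrow>\<^bsub>G\<^esub> v" if "q \<in> Q" "v \<in> B" for q v
    using that B by (auto simp: closed_out_nbhd_def)
  have "?Q2 \<subseteq> verts G" using Q(1) Q'(1) B by blast
  moreover have "\<not> x \<rightarrow>\<^bsub>G\<^esub> y" if "x \<in> ?Q2" "y \<in> ?Q2" for x y
    using that Q(2)[of x y] Q'(2)[of x y] QB[of x y] Q'(1) by blast
  ultimately have "independent_set G ?Q2" unfolding independent_set_def by blast
  moreover have "\<exists>q\<in>?Q2. v = q \<or> q \<rightarrow>\<^bsub>G\<^esub> v \<or> (\<exists>w. q \<rightarrow>\<^bsub>G\<^esub> w \<and> w \<rightarrow>\<^bsub>G\<^esub> v)" if v: "v \<in> verts G" for v
  proof -
    consider "v \<in> B" | "v \<in> Q" | q where "q \<in> Q" "q \<rightarrow>\<^bsub>G\<^esub> v"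
      using v B by (auto simp: closed_out_nbhd_def)
    then show ?thesis
    proof cases
      case 1
      then have "v \<in> verts (G \<restriction> B)" by simp
      with qk' show ?thesis
        by (cases rule: H.quasi_kernel_cases) (auto simp: dom)
    next
      case 2
      show ?thesis
      proof (cases "v \<in> R")
        case True
        then show ?thesis using R[OF True] by (auto simp: closed_out_nbhd_def dom)
      next
        case False
        then show ?thesis using 2 by blast
      qed
    next
      case 3
      then obtain t where t: "t \<in> T" "t \<rightarrow>\<^bsub>G\<^esub> v" using T by blast
      \<comment> \<open>Either \<open>t\<close> is kept, or it was removed because \<open>Q'\<close>
        dominates it; then \<open>v\<close> is two steps from \<open>Q'\<close>.\<close>
      then have "t \<in> Q - R" using \<open>T \<subseteq> Q\<close> RT by blast
      then show ?thesis using t(2) by blast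
    qed
  qed
  ultimately show ?thesis by (simp add: quasi_kernel_iff)
qed

theorem theorem1p2:
  fixes \<G> :: "('a, 'b) pre_digraph set"
    and D :: "('a, 'b) pre_digraph"
    and n :: nat
  assumes "\<forall>H\<in>\<G>. oriented_graph H"
    and "hereditary \<G>"
    and "weighted_half_nbhd_property \<G>"
    and "D \<in> \<G>"
    and "source_free D"
    and "card (verts D) = n"
  shows "\<exists>Q. quasi_kernel D Q \<and> real (card Q) \<le> 2 * real n / 3"
proof -
  interpret digraph D using assms(1,4) by (auto simp: oriented_graph_def)
  \<comment> \<open>Any weight will do here: only the existence of a quasi-kernel is wanted.\<close>
  obtain Q where qk: "quasi_kernel D Q"
    using assms(3,4) unfolding weighted_half_nbhd_property_def by blast
  then have Q: "Q \<subseteq> verts D" "\<And>x y. x \<in> Q \<Longrightarrow> y \<in> Q \<Longrightarrow> \<not> x \<rightarrow>\<^bsub>D\<^esub> y"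
    unfolding quasi_kernel_def independent_set_def by auto
  define A where "A = {v. \<exists>q\<in>Q. q \<rightarrow>\<^bsub>D\<^esub> v}"
  define B where "B = verts D - closed_out_nbhd D Q"
  have A: "A \<subseteq> verts D" "A \<inter> Q = {}" unfolding A_def using Q by auto
  then have BAQ: "verts D = Q \<union> A \<union> B" "B \<inter> (Q \<union> A) = {}"
    using Q by (auto simp: B_def A_def closed_out_nbhd_def)
  have fin: "finite Q" "finite A" "finite B"
    using BAQ(1) finite_verts by (auto intro: finite_subset)
  have card_V: "n = card Q + card A + card B"
    using assms(6) BAQ A fin by (simp add: card_Un_disjoint Int_commute)
  have "\<forall>v\<in>A. \<exists>q. q \<in> Q \<and> q \<rightarrow>\<^bsub>D\<^esub> v" unfolding A_def by blast
  from bchoice[OF this] obtain g where g: "\<And>v. v \<in> A \<Longrightarrow> g v \<in> Q \<and> g v \<rightarrow>\<^bsub>D\<^esub> v" by blast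
  define T where "T = g ` A"
  have "T \<subseteq> Q" using g by (auto simp: T_def)
  have T: "\<exists>t\<in>T. t \<rightarrow>\<^bsub>D\<^esub> v" if "q \<in> Q" "q \<rightarrow>\<^bsub>D\<^esub> v" for q v
    using that g by (auto simp: T_def A_def)
  define C where "C = {q \<in> Q - T. \<forall>t\<in>T. \<forall>u. t \<rightarrow>\<^bsub>D\<^esub> u \<longrightarrow> \<not> u \<rightarrow>\<^bsub>D\<^esub> q}"
  have "finite C" using fin(1) by (simp add: C_def)
  have qk1: "quasi_kernel D (T \<union> C)"
    unfolding C_def using quasi_kernel_prune[OF qk \<open>T \<subseteq> Q\<close> T] .
  have card1: "card (T \<union> C) \<le> card A + card C"
    using card_Un_le[of T C] card_image_le[OF fin(2), of g] by (simp add: T_def)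
  have "\<forall>q\<in>C. \<exists>u. u \<in> B \<and> u \<rightarrow>\<^bsub>D\<^esub> q"
  proof
    fix q assume "q \<in> C"
    then have "q \<in> Q" by (simp add: C_def)
    then obtain u where u: "u \<in> verts D" "u \<rightarrow>\<^bsub>D\<^esub> q"
      using assms(5) Q(1) unfolding source_free_def source_def by blast
    \<comment> \<open>If \<open>u\<close> were in \<open>A\<close>, it would be dominated by
      \<open>T\<close>, and the definition of \<open>C\<close> would exclude
      \<open>q\<close>.\<close>
    have "u \<notin> A" using \<open>q \<in> C\<close> u(2) T unfolding A_def C_def by blast
    moreover have "u \<notin> Q" using Q(2) u(2) \<open>q \<in> Q\<close> by blast
    ultimately show "\<exists>u. u \<in> B \<and> u \<rightarrow>\<^bsub>D\<^esub> q" using u BAQ(1) by blast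
  qed
  from bchoice[OF this] obtain p where p: "\<And>q. q \<in> C \<Longrightarrow> p q \<in> B \<and> p q \<rightarrow>\<^bsub>D\<^esub> q" by blast
  have "B \<subseteq> verts D" by (auto simp: B_def)
  then have "D \<restriction> B \<in> \<G>"
    using assms(2,4) induced_induce unfolding hereditary_def by blast
  define f where "f x = card {q \<in> C. p q = x}" for x
  have "\<exists>Q'. quasi_kernel (D \<restriction> B) Q' \<and>
      real (sum f (closed_out_nbhd (D \<restriction> B) Q')) \<ge> real (sum f (verts (D \<restriction> B))) / 2"
    using assms(3) \<open>D \<restriction> B \<in> \<G>\<close> unfolding weighted_half_nbhd_property_def by blast
  then obtain Q' where qk': "quasi_kernel (D \<restriction> B) Q'"
    and half: "real (sum f (closed_out_nbhd (D \<restriction> B) Q')) \<ge> real (sum f B) / 2"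
    by auto
  define N where "N = closed_out_nbhd (D \<restriction> B) Q'"
  define R where "R = {q \<in> C. p q \<in> N}"
  have "Q' \<subseteq> B" using qk' by (simp add: quasi_kernel_def independent_set_def)
  then have "N \<subseteq> B" by (auto simp: N_def closed_out_nbhd_def)
  \<comment> \<open>The fibres of \<open>p\<close> are disjoint. Taking \<open>S\<close> to be
    \<open>B\<close> gives \<open>card C\<close>, and taking it to be \<open>N\<close> gives
    \<open>card R\<close>, so \<open>half\<close> becomes a bound on \<open>card R\<close>.\<close>
  have fibres: "sum f S = card {q \<in> C. p q \<in> S}" if "finite S" for S
  proof -
    have "card (\<Union>x\<in>S. {q \<in> C. p q = x}) = sum f S"
      unfolding f_def using that \<open>finite C\<close> by (intro card_UN_disjoint) auto
    moreover have "(\<Union>x\<in>S. {q \<in> C. p q = x}) = {q \<in> C. p q \<in> S}" by blast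
    ultimately show ?thesis by simp
  qed
  have "{q \<in> C. p q \<in> B} = C" using p by blast
  then have card_R: "real (card R) \<ge> real (card C) / 2"
    using half fibres[of B] fibres[of N] fin(3) finite_subset[OF \<open>N \<subseteq> B\<close> fin(3)]
    by (simp only: N_def R_def)
  have "R \<subseteq> Q" "R \<inter> T = {}" by (auto simp: R_def C_def)
  define Q2 where "Q2 = Q' \<union> (Q - R - {v. \<exists>q\<in>Q'. q \<rightarrow>\<^bsub>D\<^esub> v})"
  have qk2: "quasi_kernel D Q2"
    unfolding Q2_def using p
    by (intro quasi_kernel_exchange[OF qk \<open>T \<subseteq> Q\<close> T B_def qk' \<open>R \<inter> T = {}\<close>])
      (auto simp: R_def N_def)
  \<comment> \<open>A crude bound suffices: \<open>Q'\<close> is replaced by all of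
    \<open>B\<close>, and only the removal of \<open>R\<close> from \<open>Q\<close> is
    counted.\<close>
  have "card Q2 \<le> card (B \<union> (Q - R))"
    using \<open>Q' \<subseteq> B\<close> fin by (intro card_mono) (auto simp: Q2_def)
  also have "\<dots> \<le> card B + (card Q - card R)"
    using card_Un_le[of B "Q - R"] card_Diff_subset[OF finite_subset[OF \<open>R \<subseteq> Q\<close> fin(1)] \<open>R \<subseteq> Q\<close>]
    by simp
  finally have "real (card Q2) \<le> real n - card A - card R"
    using card_V card_mono[OF fin(1) \<open>R \<subseteq> Q\<close>] by simp
  then have "real (card (T \<union> C)) \<le> 2 * real n / 3 \<or> real (card Q2) \<le> 2 * real n / 3"
    using card1 card_R by linarith
  then show ?thesis using qk1 qk2 by blast
qed

end
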